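(* Let $(\mathcal{H},[\cdot,\cdot])$ be a Krein space with fundamental symmetry $J$. Then every $J$-frame $\mathcal{F}=\{f_i\}_{i\in I}$ for $\mathcal{H}$ is a frame for the associated Hilbert space $(\mathcal{H},\langle\cdot,\cdot\rangle)$, i.e. there exist constants $0<A\le B<\infty$ such that $A\|f\|^2\le\sum_{i\in I}|\langle f,f_i\rangle|^2\le B\|f\|^2$ for every $f\in\mathcal{H}$.
   Context: Krein space setting: $(\mathcal{H},[\cdot,\cdot])$ is a complex separable Krein space with a fixed fundamental decomposition $\mathcal{H}=\mathcal{H}_+\dotplus\mathcal{H}_-$ (the summands are $[\cdot,\cdot]$-orthogonal and $(\mathcal{H}_\pm,\pm[\cdot,\cdot])$ are Hilbert spaces). $\langle\cdot,\cdot\rangle$ is the inner product making $\mathcal{H}$ the orthogonal direct sum of these Hilbert spaces, $\|\cdot\|$ its norm, and the fundamental symmetry $J$ (a selfadjoint unitary) satisfies $[x,y]=\langle Jx,y\rangle$. A subspace $\mathcal{S}$ is uniformly $J$-positive (resp. uniformly $J$-negative) if there is $\alpha>0$ with $[x,x]\ge\alpha\|x\|^2$ (resp. $[x,x]\le-\alpha\|x\|^2$) for all $x\in\mathcal{S}$. "Maximal" means maximal with respect to inclusion among such subspaces. A Bessel family is a family $\mathcal{F}=\{f_i\}_{i\in I}$ in $\mathcal{H}$ with $\sum_i|\langle f,f_i\rangle|^2\le B\|f\|^2$ for all $f$ and some $B<\infty$. Its synthesis operator is the bounded operator $T:\ell_2(I)\to\mathcal{H}$, $Te_i=f_i$, with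 $\{e_i\}$ the standard orthonormal basis. Let $I_+=\{i:[f_i,f_i]\ge0\}$, $I_-=\{i:[f_i,f_i]<0\}$, $P_\pm$ the orthogonal projection of $\ell_2(I)$ onto $\ell_2(I_\pm)$, and $T_\pm=TP_\pm$. The Bessel family $\mathcal{F}$ is a $J$-frame for $\mathcal{H}$ if the range $R(T_+)$ is a maximal uniformly $J$-positive subspace and $R(T_-)$ is a maximal uniformly $J$-negative subspace of $\mathcal{H}$. *)

theory Defs
  imports "HOL-Analysis.Analysis"
begin

section \<open>Krein spaces with a fixed fundamental decomposition\<close>

locale fundamental_decomposition =
  vector_space scale
  for scale :: "complex \<Rightarrow> 'a::ab_group_add \<Rightarrow> 'a"  (infixr "*\<^sub>C" 75) +
  fixes form :: "'a \<Rightarrow> 'a \<Rightarrow> complex"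
    and Hp Hm :: "'a set"
  assumes form_add_left: "form (x + y) z = form x z + form y z"
    and form_scale_left: "form (a *\<^sub>C x) y = a * form x y"
    and form_hermitian: "form y x = cnj (form x y)"
    and subspace_Hp: "subspace Hp"
    and subspace_Hm: "subspace Hm"
    and decomp_ex: "\<exists>p\<in>Hp. \<exists>m\<in>Hm. x = p + m"
    and decomp_direct: "Hp \<inter> Hm = {0}"
    and decomp_orth: "\<lbrakk>p \<in> Hp; m \<in> Hm\<rbrakk> \<Longrightarrow> form p m = 0"
    and form_pos: "\<lbrakk>p \<in> Hp; p \<noteq> 0\<rbrakk> \<Longrightarrow> Re (form p p) > 0"
    and form_neg: "\<lbrakk>m \<in> Hm; m \<noteq> 0\<rbrakk> \<Longrightarrow> Re (form m m) < 0"
begin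

definition proj_p :: "'a \<Rightarrow> 'a"
  where "proj_p x = (THE p. p \<in> Hp \<and> x - p \<in> Hm)"

definition proj_m :: "'a \<Rightarrow> 'a"
  where "proj_m x = x - proj_p x"

text \<open>The inner product for which the space is the orthogonal direct sum of
  \<open>Hp\<close> with \<open>form\<close> and \<open>Hm\<close> with \<open>- form\<close>.\<close>

definition hinner :: "'a \<Rightarrow> 'a \<Rightarrow> complex"
  where "hinner x y = form (proj_p x) (proj_p y) - form (proj_m x) (proj_m y)"

definition fundamental_symmetry :: "'a \<Rightarrow> 'a"
  where "fundamental_symmetry x = proj_p x - proj_m x"

lemma proj_pI:
  assumes "p \<in> Hp" "m \<in> Hm"
  shows "proj_p (p + m) = p" "proj_m (p + m) = m"
proof -
  have "q = p" if "q \<in> Hp \<and> p + m - q \<in> Hm" for q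
  proof -
    have "p - q \<in> Hp" using that assms subspace_Hp subspace_diff by blast
    moreover have "p + m - q - m \<in> Hm" using that assms subspace_Hm subspace_diff by blast
    hence "p - q \<in> Hm" by (simp add: algebra_simps)
    ultimately have "p - q \<in> Hp \<inter> Hm" by blast
    thus "q = p" by (simp only: decomp_direct singleton_iff right_minus_eq)
  qed
  thus "proj_p (p + m) = p"
    unfolding proj_p_def using assms by (intro the_equality) simp_all
  thus "proj_m (p + m) = m" by (simp add: proj_m_def)
qed

lemma proj_p_in: "proj_p x \<in> Hp" and proj_m_in: "proj_m x \<in> Hm"
proof -
  obtain p m where "p \<in> Hp" "m \<in> Hm" "x = p + m" using decomp_ex[of x] by blast
  thus "proj_p x \<in> Hp" "proj_m x \<in> Hm" by (simp_all only: proj_pI)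
qed

lemma proj_add: "proj_p x + proj_m x = x"
  by (simp add: proj_m_def)

lemma form_add_right: "form x (y + z) = form x y + form x z"
proof -
  have "form x (y + z) = cnj (form (y + z) x)" by (rule form_hermitian)
  also have "\<dots> = cnj (form y x) + cnj (form z x)" by (simp only: form_add_left complex_cnj_add)
  also have "\<dots> = form x y + form x z"
    by (simp only: form_hermitian[of x y, symmetric] form_hermitian[of x z, symmetric])
  finally show ?thesis .
qed

lemma form_minus_left: "form (- x) y = - form x y"
  using form_scale_left[of "- 1" x y] by simp

lemma form_eq_hinner: "form x y = hinner (fundamental_symmetry x) y"
proof -
  have "- proj_m x \<in> Hm" by (rule subspace_neg[OF subspace_Hm proj_m_in])
  note J = proj_pI[OF proj_p_in[of x] this]
  have orth: "form (proj_p u) (proj_m v) = 0" for u v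
    by (rule decomp_orth[OF proj_p_in proj_m_in])
  have orth': "form (proj_m v) (proj_p u) = 0" for u v
    using form_hermitian[of "proj_p u" "proj_m v"] form_hermitian[of "proj_m v" "proj_p u"]
    by (simp only: orth complex_cnj_zero)
  have "form x y = form (proj_p x + proj_m x) (proj_p y + proj_m y)"
    by (simp only: proj_add)
  also have "\<dots> = form (proj_p x) (proj_p y) + form (proj_m x) (proj_m y)"
    by (simp only: form_add_left form_add_right orth orth' add_0_left add_0_right)
  also have "\<dots> = hinner (fundamental_symmetry x) y"
    by (simp only: hinner_def fundamental_symmetry_def diff_conv_add_uminus J form_minus_left
        minus_minus)
  finally show ?thesis .
qed

end

text \<open>The library norm of the carrier type is tied to the norm induced by \<open>hinner\<close>, so that
  convergence, completeness and separability are the library notions. On \<open>Hp\<close> and \<open>Hm\<close>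
  it restricts to the norms induced by \<open>form\<close> and \<open>- form\<close>.\<close>

locale krein_space =
  fundamental_decomposition scale form Hp Hm
  for scale :: "complex \<Rightarrow> 'a::real_normed_vector \<Rightarrow> 'a"  (infixr "*\<^sub>C" 75)
    and form :: "'a \<Rightarrow> 'a \<Rightarrow> complex"
    and Hp Hm :: "'a set" +
  assumes scale_of_real: "complex_of_real r *\<^sub>C x = r *\<^sub>R x"
    and norm_eq_hinner: "norm x = sqrt (Re (hinner x x))"
    and complete_Hp: "complete Hp"
    and complete_Hm: "complete Hm"
    and separable: "separable_space (euclidean :: 'a topology)"


section \<open>The space $\ell_2(I)$\<close>

text \<open>Sequences indexed by \<open>I\<close> are represented by functions vanishing outside \<open>I\<close>, so that
  \<open>ell2 K \<subseteq> ell2 I\<close> for \<open>K \<subseteq> I\<close>.\<close>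

definition ell2 :: "'i set \<Rightarrow> ('i \<Rightarrow> complex) set"
  where "ell2 I = {c. (\<forall>i. i \<notin> I \<longrightarrow> c i = 0) \<and> (\<lambda>i. (cmod (c i))\<^sup>2) summable_on I}"

definition ell2_norm :: "'i set \<Rightarrow> ('i \<Rightarrow> complex) \<Rightarrow> real"
  where "ell2_norm I c = sqrt (\<Sum>\<^sub>\<infinity>i\<in>I. (cmod (c i))\<^sup>2)"

definition ell2_unit :: "'i \<Rightarrow> 'i \<Rightarrow> complex"
  where "ell2_unit i = (\<lambda>j. if j = i then 1 else 0)"

definition ell2_proj :: "'i set \<Rightarrow> ('i \<Rightarrow> complex) \<Rightarrow> 'i \<Rightarrow> complex"
  where "ell2_proj K c = (\<lambda>i. if i \<in> K then c i else 0)"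

text \<open>For \<open>K \<subseteq> I\<close>, \<open>ell2_proj K\<close> is the orthogonal projection of \<open>ell2 I\<close> onto \<open>ell2 K\<close>.\<close>

lemma ell2_proj_orthogonal:
  assumes "K \<subseteq> I" and "c \<in> ell2 I"
  shows "ell2_proj K c \<in> ell2 K"
    and "d \<in> ell2 K \<Longrightarrow> (\<Sum>\<^sub>\<infinity>i\<in>I. (c i - ell2_proj K c i) * cnj (d i)) = 0"
proof -
  have "(\<lambda>i. (cmod (c i))\<^sup>2) summable_on K"
    using assms unfolding ell2_def by (auto intro: summable_on_subset_banach)
  hence "(\<lambda>i. (cmod (ell2_proj K c i))\<^sup>2) summable_on K"
    by (rule summable_on_cong[THEN iffD1, rotated]) (simp add: ell2_proj_def)
  thus "ell2_proj K c \<in> ell2 K"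
    by (auto simp: ell2_def ell2_proj_def)
  show "(\<Sum>\<^sub>\<infinity>i\<in>I. (c i - ell2_proj K c i) * cnj (d i)) = 0" if "d \<in> ell2 K"
    using that by (intro infsum_0) (auto simp: ell2_def ell2_proj_def)
qed


section \<open>\<open>J\<close>-frames\<close>

context krein_space
begin

definition uniformly_pos :: "'a set \<Rightarrow> bool"
  where "uniformly_pos S \<longleftrightarrow>
    subspace S \<and> (\<exists>\<alpha>>0. \<forall>x\<in>S. Re (form x x) \<ge> \<alpha> * (norm x)\<^sup>2)"

definition uniformly_neg :: "'a set \<Rightarrow> bool"
  where "uniformly_neg S \<longleftrightarrow>
    subspace S \<and> (\<exists>\<alpha>>0. \<forall>x\<in>S. Re (form x x) \<le> - \<alpha> * (norm x)\<^sup>2)"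

definition max_uniformly_pos :: "'a set \<Rightarrow> bool"
  where "max_uniformly_pos S \<longleftrightarrow>
    uniformly_pos S \<and> (\<forall>S'. uniformly_pos S' \<and> S \<subseteq> S' \<longrightarrow> S' = S)"

definition max_uniformly_neg :: "'a set \<Rightarrow> bool"
  where "max_uniformly_neg S \<longleftrightarrow>
    uniformly_neg S \<and> (\<forall>S'. uniformly_neg S' \<and> S \<subseteq> S' \<longrightarrow> S' = S)"

definition bessel_family :: "'i set \<Rightarrow> ('i \<Rightarrow> 'a) \<Rightarrow> bool"
  where "bessel_family I f \<longleftrightarrow>
    (\<exists>B. \<forall>x. (\<lambda>i. (cmod (hinner x (f i)))\<^sup>2) summable_on I \<and>
             (\<Sum>\<^sub>\<infinity>i\<in>I. (cmod (hinner x (f i)))\<^sup>2) \<le> B * (norm x)\<^sup>2)"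

definition bounded_ell2_operator :: "'i set \<Rightarrow> (('i \<Rightarrow> complex) \<Rightarrow> 'a) \<Rightarrow> bool"
  where "bounded_ell2_operator I T \<longleftrightarrow>
    (\<forall>c\<in>ell2 I. \<forall>d\<in>ell2 I. T (\<lambda>i. c i + d i) = T c + T d) \<and>
    (\<forall>a. \<forall>c\<in>ell2 I. T (\<lambda>i. a * c i) = a *\<^sub>C T c) \<and>
    (\<exists>K. \<forall>c\<in>ell2 I. norm (T c) \<le> K * ell2_norm I c)"

text \<open>The requirement off \<open>ell2 I\<close> only fixes junk values, so that the operator is unique as a
  total function. For families that are not Bessel the value is meaningless.\<close>

definition synthesis :: "'i set \<Rightarrow> ('i \<Rightarrow> 'a) \<Rightarrow> ('i \<Rightarrow> complex) \<Rightarrow> 'a"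
  where "synthesis I f = (THE T. bounded_ell2_operator I T \<and>
    (\<forall>i\<in>I. T (ell2_unit i) = f i) \<and> (\<forall>c. c \<notin> ell2 I \<longrightarrow> T c = 0))"

definition index_pos :: "'i set \<Rightarrow> ('i \<Rightarrow> 'a) \<Rightarrow> 'i set"
  where "index_pos I f = {i\<in>I. Re (form (f i) (f i)) \<ge> 0}"

definition index_neg :: "'i set \<Rightarrow> ('i \<Rightarrow> 'a) \<Rightarrow> 'i set"
  where "index_neg I f = {i\<in>I. Re (form (f i) (f i)) < 0}"

definition synthesis_pos :: "'i set \<Rightarrow> ('i \<Rightarrow> 'a) \<Rightarrow> ('i \<Rightarrow> complex) \<Rightarrow> 'a"
  where "synthesis_pos I f = synthesis I f \<circ> ell2_proj (index_pos I f)"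

definition synthesis_neg :: "'i set \<Rightarrow> ('i \<Rightarrow> 'a) \<Rightarrow> ('i \<Rightarrow> complex) \<Rightarrow> 'a"
  where "synthesis_neg I f = synthesis I f \<circ> ell2_proj (index_neg I f)"

definition j_frame :: "'i set \<Rightarrow> ('i \<Rightarrow> 'a) \<Rightarrow> bool"
  where "j_frame I f \<longleftrightarrow> bessel_family I f \<and>
    max_uniformly_pos (synthesis_pos I f ` ell2 I) \<and>
    max_uniformly_neg (synthesis_neg I f ` ell2 I)"

definition hilbert_frame :: "'i set \<Rightarrow> ('i \<Rightarrow> 'a) \<Rightarrow> bool"
  where "hilbert_frame I f \<longleftrightarrow>
    (\<exists>A B. 0 < A \<and> A \<le> B \<and>
      (\<forall>x. (\<lambda>i. (cmod (hinner x (f i)))\<^sup>2) summable_on I \<and>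
           A * (norm x)\<^sup>2 \<le> (\<Sum>\<^sub>\<infinity>i\<in>I. (cmod (hinner x (f i)))\<^sup>2) \<and>
           (\<Sum>\<^sub>\<infinity>i\<in>I. (cmod (hinner x (f i)))\<^sup>2) \<le> B * (norm x)\<^sup>2))"

end

end

theory Submission
  imports Defs
begin

text \<open>A maximal uniformly positive subspace is the graph over \<open>Hp\<close> of a strict contraction into
  \<open>Hm\<close>: a vector of \<open>Hp\<close> orthogonal to its projection could be adjoined to it. Dually for
  negative subspaces, and by Banach's fixed point theorem two such graphs span the whole space.
  Hence the synthesis operator \<open>T\<close> of a \<open>J\<close>-frame is onto. Since \<open>\<langle>x, T c\<rangle>\<close> is bounded by
  \<open>\<parallel>c\<parallel>\<close> times \<open>S x\<close>, the square root of the frame sum at \<open>x\<close>, the set of all \<open>x\<close> with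
  \<open>S x \<le> 1\<close> is weakly bounded, hence bounded, which is the lower frame bound.\<close>

text \<open>Cauchy criterion for unconditional sums: once the tails outside \<open>F0\<close> are
  small, all partial sums over finite sets above \<open>F0\<close> are close to the one over
  \<open>F0\<close>. Completeness is a hypothesis on \<open>UNIV\<close> because for the carrier of
  a Krein space it has to be derived first (\<open>complete_UNIV_krein\<close>).\<close>

lemma summable_on_if_small_tails:
  fixes g :: "'i \<Rightarrow> 'a::real_normed_vector"
  assumes compl: "complete (UNIV :: 'a set)"
    and tails: "\<And>e. e > 0 \<Longrightarrow> \<exists>F0. finite F0 \<and> F0 \<subseteq> A \<and>
      (\<forall>F. finite F \<and> F \<subseteq> A - F0 \<longrightarrow> norm (sum g F) < e)"
  shows "g summable_on A"
proof -
  have "cauchy_filter (filtermap (sum g) (finite_subsets_at_top A))"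
    unfolding cauchy_filter_metric_filtermap
  proof (intro allI impI)
    fix e :: real assume "e > 0"
    then obtain F0 where F0: "finite F0" "F0 \<subseteq> A"
      and small: "\<And>F. finite F \<Longrightarrow> F \<subseteq> A - F0 \<Longrightarrow> norm (sum g F) < e / 2"
      using tails[of "e / 2"] by (metis half_gt_zero)
    define P where "P F \<longleftrightarrow> finite F \<and> F0 \<subseteq> F \<and> F \<subseteq> A" for F
    have "dist (sum g F) (sum g F0) < e / 2" if "P F" for F
      using that small[of "F - F0"] by (auto simp: P_def dist_norm sum_diff)
    hence "dist (sum g F) (sum g G) < e" if "P F" "P G" for F G
      using that by (meson dist_triangle_half_l)
    moreover have "eventually P (finite_subsets_at_top A)"
      using F0 unfolding P_def eventually_finite_subsets_at_top by blast
    ultimately show "\<exists>P. eventually P (finite_subsets_at_top A) \<and>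
        (\<forall>F G. P F \<and> P G \<longrightarrow> dist (sum g F) (sum g G) < e)"
      by blast
  qed
  with compl obtain L where "filtermap (sum g) (finite_subsets_at_top A) \<le> nhds L"
    unfolding complete_uniform by (force simp: filtermap_bot_iff)
  thus ?thesis
    unfolding summable_on_def has_sum_def filterlim_def by blast
qed

section \<open>Complex inner product spaces\<close>

text \<open>Isolates what concerns a definite inner product alone; \<open>hinner\<close> becomes an
  instance below. The axiom \<open>of_real_scale\<close> ties the complex scalars to the real
  structure of the type, so that convergence and boundedness are the type's own notions.\<close>

locale complex_inner_space =
  vector_space scale
  for scale :: "complex \<Rightarrow> 'a::real_normed_vector \<Rightarrow> 'a"  (infixr "*\<^sub>C" 75) +
  fixes ip :: "'a \<Rightarrow> 'a \<Rightarrow> complex"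
  assumes ip_add_left: "ip (x + y) z = ip x z + ip y z"
    and ip_scale_left: "ip (a *\<^sub>C x) y = a * ip x y"
    and ip_hermitian: "ip y x = cnj (ip x y)"
    and of_real_scale: "complex_of_real r *\<^sub>C x = r *\<^sub>R x"
    and Re_ip_self: "Re (ip x x) = (norm x)\<^sup>2"
begin

lemma ip_add_right: "ip x (y + z) = ip x y + ip x z"
  by (metis ip_hermitian ip_add_left complex_cnj_add)

lemma ip_scale_right: "ip x (a *\<^sub>C y) = cnj a * ip x y"
  by (metis ip_hermitian ip_scale_left complex_cnj_mult)

lemma ip_zero_left [simp]: "ip 0 x = 0"
  using ip_add_left[of 0 0 x] by simp

lemma ip_zero_right [simp]: "ip x 0 = 0"
  using ip_add_right[of x 0 0] by simp

lemma ip_minus_left: "ip (- x) y = - ip x y"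
  using ip_add_left[of x "- x" y] by (simp add: eq_neg_iff_add_eq_0 add.commute)

lemma ip_minus_right: "ip x (- y) = - ip x y"
  using ip_add_right[of x y "- y"] by (simp add: eq_neg_iff_add_eq_0 add.commute)

lemma ip_diff_left: "ip (x - y) z = ip x z - ip y z"
  using ip_add_left[of x "- y" z] by (simp add: ip_minus_left)

lemma ip_sum_right: "ip x (sum g F) = (\<Sum>i\<in>F. ip x (g i))"
  by (induction F rule: infinite_finite_induct) (simp_all add: ip_add_right)

lemma ip_self: "ip x x = complex_of_real ((norm x)\<^sup>2)"
  using ip_hermitian[of x x] Re_ip_self[of x] by (simp add: complex_eq_iff)

lemma Re_ip_commute: "Re (ip y x) = Re (ip x y)"
  using ip_hermitian[of y x] by simp

lemma norm_add_sq: "(norm (x + y))\<^sup>2 = (norm x)\<^sup>2 + 2 * Re (ip x y) + (norm y)\<^sup>2"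
  using Re_ip_commute[of x y]
  by (simp add: Re_ip_self[symmetric] ip_add_left ip_add_right del: Re_ip_self)

lemma norm_diff_sq: "(norm (x - y))\<^sup>2 = (norm x)\<^sup>2 - 2 * Re (ip x y) + (norm y)\<^sup>2"
  using norm_add_sq[of x "- y"] by (simp add: ip_minus_right)

text \<open>The type gives homogeneity of the norm for real scalars only; for complex ones it comes
  from \<open>Re_ip_self\<close>.\<close>

lemma norm_scale: "norm (a *\<^sub>C x) = cmod a * norm x"
proof -
  have "(norm (a *\<^sub>C x))\<^sup>2 = Re ((a * cnj a) * ip x x)"
    by (simp add: Re_ip_self[symmetric] ip_scale_left ip_scale_right mult_ac del: Re_ip_self)
  also have "\<dots> = (cmod a * norm x)\<^sup>2"
    by (simp only: complex_norm_square[symmetric] ip_self power_mult_distrib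
        flip: of_real_power of_real_mult) simp
  finally show ?thesis
    by (simp add: power2_eq_iff_nonneg)
qed

text \<open>The coefficient is the one for which the difference is orthogonal to \<open>y\<close>,
  so this is Pythagoras. Nonnegativity of the left side yields \<open>Cauchy_Schwarz\<close>, and
  minimality of \<open>norm x\<close> yields \<open>orthogonal_if_norm_minimal\<close>.\<close>

lemma norm_diff_component_sq:
  assumes "y \<noteq> 0"
  shows "(norm (x - (ip x y / complex_of_real ((norm y)\<^sup>2)) *\<^sub>C y))\<^sup>2
    = (norm x)\<^sup>2 - (cmod (ip x y))\<^sup>2 / (norm y)\<^sup>2"
proof -
  define a where "a = ip x y / complex_of_real ((norm y)\<^sup>2)"
  have "cnj a * ip x y = complex_of_real ((cmod (ip x y))\<^sup>2 / (norm y)\<^sup>2)"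
    by (simp add: a_def complex_norm_square mult_ac del: of_real_power)
  hence "Re (cnj a * ip x y) = (cmod (ip x y))\<^sup>2 / (norm y)\<^sup>2"
    by (simp only: Re_complex_of_real)
  moreover have "cmod a * norm y = cmod (ip x y) / norm y"
    using assms by (simp add: a_def norm_divide norm_power power2_eq_square norm_mult)
  ultimately have "(norm (x - a *\<^sub>C y))\<^sup>2 = (norm x)\<^sup>2 - (cmod (ip x y))\<^sup>2 / (norm y)\<^sup>2"
    by (simp only: norm_diff_sq ip_scale_right norm_scale power_divide)
  thus ?thesis
    by (simp only: a_def)
qed

lemma orthogonal_if_norm_minimal:
  assumes "\<And>a. norm v \<le> norm (v - a *\<^sub>C n)"
  shows "ip v n = 0"
proof (cases "n = 0")
  case False
  have "(norm v)\<^sup>2 \<le> (norm v)\<^sup>2 - (cmod (ip v n))\<^sup>2 / (norm n)\<^sup>2"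
    using assms norm_diff_component_sq[OF False, of v] by (metis norm_ge_zero power_mono)
  thus ?thesis
    using False by (simp add: field_simps)
qed simp

lemma Cauchy_Schwarz: "cmod (ip x y) \<le> norm x * norm y"
proof (cases "y = 0")
  case False
  have "0 \<le> (norm x)\<^sup>2 - (cmod (ip x y))\<^sup>2 / (norm y)\<^sup>2"
    using norm_diff_component_sq[OF False, of x] by (metis zero_le_power2)
  hence "(cmod (ip x y))\<^sup>2 \<le> (norm x * norm y)\<^sup>2"
    using False by (simp add: field_simps)
  thus ?thesis
    by (simp add: power2_le_iff_abs_le)
qed simp

lemma continuous_on_ip_right: "continuous_on S (ip x)"
proof -
  \<comment> \<open>Conjugate linearity in the second argument is real linearity, which is what
    \<open>bounded_linear\<close> means.\<close>
  have "bounded_linear (ip x)"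
    by (rule bounded_linear_intro[where K = "norm x"])
      (simp_all add: ip_add_right ip_scale_right Cauchy_Schwarz mult.commute[of _ "norm x"]
        scaleR_conv_of_real flip: of_real_scale)
  thus ?thesis
    by (rule linear_continuous_on)
qed

lemma bounded_linear_scale: "bounded_linear (\<lambda>x. a *\<^sub>C x)"
  by (rule bounded_linear_intro[where K = "cmod a"])
    (simp_all add: scale_right_distrib norm_scale mult.commute flip: of_real_scale)

lemma subspace_closure:
  assumes "subspace S"
  shows "subspace (closure S)"
proof (rule subspaceI)
  show "0 \<in> closure S" using subspace_0[OF assms] closure_subset by blast
next
  fix x y assume "x \<in> closure S" "y \<in> closure S"
  then obtain s t where "\<And>n. s n \<in> S" "s \<longlonglongrightarrow> x" "\<And>n. t n \<in> S" "t \<longlonglongrightarrow> y"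
    unfolding closure_sequential by blast
  thus "x + y \<in> closure S"
    unfolding closure_sequential
    by (intro exI[of _ "\<lambda>n. s n + t n"]) (auto intro: tendsto_add subspace_add[OF assms])
next
  fix a x assume "x \<in> closure S"
  then obtain s where "\<And>n. s n \<in> S" "s \<longlonglongrightarrow> x"
    unfolding closure_sequential by blast
  thus "a *\<^sub>C x \<in> closure S"
    unfolding closure_sequential
    by (intro exI[of _ "\<lambda>n. a *\<^sub>C s n"])
      (auto intro: bounded_linear.tendsto[OF bounded_linear_scale] subspace_scale[OF assms])
qed

section \<open>Orthogonal projection and uniform boundedness\<close>

lemma parallelogram:
  fixes x y :: 'a
  shows "(norm (x + y))\<^sup>2 + (norm (x - y))\<^sup>2 = 2 * (norm x)\<^sup>2 + 2 * (norm y)\<^sup>2"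
  using norm_add_sq[of x y] norm_diff_sq[of x y] by linarith

text \<open>The parallelogram law makes a minimizing sequence for the distance from \<open>u\<close>
  Cauchy, and a point at minimal distance leaves an orthogonal remainder. Completeness is asked of
  \<open>N\<close> only.\<close>

theorem projection:
  assumes N: "subspace N" "complete N"
  obtains w where "w \<in> N" "\<And>n. n \<in> N \<Longrightarrow> ip (u - w) n = 0"
proof -
  define d where "d = infdist u N"
  have ne: "N \<noteq> {}" using subspace_0[OF N(1)] by blast
  have d_le: "d \<le> norm (u - n)" if "n \<in> N" for n
    using infdist_le[OF that, of u] by (simp add: d_def dist_norm)
  have d0: "0 \<le> d" by (simp add: d_def infdist_nonneg)
  \<comment> \<open>The error is added to the squared distance, since the parallelogram law compares
    squares.\<close>
  have "\<exists>n\<in>N. (norm (u - n))\<^sup>2 < d\<^sup>2 + e" if "e > 0" for e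
  proof -
    have "d < sqrt (d\<^sup>2 + e)" using that d0 by (simp add: real_less_rsqrt)
    hence "Inf (dist u ` N) < sqrt (d\<^sup>2 + e)" using ne by (simp add: d_def infdist_notempty)
    then obtain n where n: "n \<in> N" "norm (u - n) < sqrt (d\<^sup>2 + e)"
      using cInf_lessD[of "dist u ` N"] ne by (auto simp: dist_norm)
    have "(norm (u - n))\<^sup>2 < (sqrt (d\<^sup>2 + e))\<^sup>2"
      using n(2) by (intro power_strict_mono) auto
    with n(1) that show ?thesis by (auto simp: add_nonneg_nonneg)
  qed
  hence "\<exists>n\<in>N. (norm (u - n))\<^sup>2 < d\<^sup>2 + inverse (real (Suc k))" for k
    by simp
  then obtain s where s: "\<And>k. s k \<in> N" "\<And>k. (norm (u - s k))\<^sup>2 < d\<^sup>2 + inverse (real (Suc k))"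
    by metis
  have near: "(norm (s k - s l))\<^sup>2 \<le> 2 * inverse (real (Suc k)) + 2 * inverse (real (Suc l))" for k l
  proof -
    \<comment> \<open>The midpoint is no closer to \<open>u\<close> than \<open>d\<close>. This
      bounds the sum term of the parallelogram law from below and hence the difference term from
      above.\<close>
    have "(1/2) *\<^sub>R (s k + s l) \<in> N"
      using subspace_scale[OF N(1) subspace_add[OF N(1) s(1) s(1)], of "complex_of_real (1/2)" k l]
      by (simp only: of_real_scale)
    hence "d \<le> norm (u - (1/2) *\<^sub>R (s k + s l))" by (rule d_le)
    hence "2 * d \<le> norm (2 *\<^sub>R (u - (1/2) *\<^sub>R (s k + s l)))" by simp
    also have "2 *\<^sub>R (u - (1/2) *\<^sub>R (s k + s l)) = (u - s k) + (u - s l)"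
      by (simp add: algebra_simps scaleR_2)
    finally have "(2 * d)\<^sup>2 \<le> (norm ((u - s k) + (u - s l)))\<^sup>2"
      using d0 by (intro power_mono) auto
    with parallelogram[of "u - s k" "u - s l"] s(2)[of k] s(2)[of l]
    show ?thesis
      by (simp add: norm_minus_commute power_mult_distrib)
  qed
  have "Cauchy s"
  proof (rule metric_CauchyI)
    fix e :: real assume e: "e > 0"
    then obtain M where M: "inverse (real (Suc M)) < e\<^sup>2 / 4"
      using reals_Archimedean[of "e\<^sup>2 / 4"] by auto
    have "dist (s k) (s l) < e" if "k \<ge> M" "l \<ge> M" for k l
    proof -
      have "inverse (real (Suc k)) \<le> inverse (real (Suc M))"
        "inverse (real (Suc l)) \<le> inverse (real (Suc M))"
        using that by (auto intro: le_imp_inverse_le)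
      hence "(norm (s k - s l))\<^sup>2 < e\<^sup>2" using near[of k l] M by linarith
      thus ?thesis using e by (simp add: dist_norm power_less_imp_less_base)
    qed
    thus "\<exists>M. \<forall>m\<ge>M. \<forall>n\<ge>M. dist (s m) (s n) < e" by blast
  qed
  then obtain w where w: "w \<in> N" "s \<longlonglongrightarrow> w"
    using N(2) s(1) unfolding complete_def by blast
  have "(norm (u - w))\<^sup>2 \<le> d\<^sup>2"
  proof (rule LIMSEQ_le)
    show "(\<lambda>k. (norm (u - s k))\<^sup>2) \<longlonglongrightarrow> (norm (u - w))\<^sup>2"
      by (intro tendsto_intros w)
    show "(\<lambda>k. d\<^sup>2 + inverse (real (Suc k))) \<longlonglongrightarrow> d\<^sup>2"
      using tendsto_add[OF tendsto_const LIMSEQ_inverse_real_of_nat, of "d\<^sup>2"] by simp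
  qed (use s(2) less_imp_le in blast)
  hence le: "norm (u - w) \<le> d" using d0 by (simp add: power2_le_iff_abs_le)
  have "ip (u - w) n = 0" if "n \<in> N" for n
  proof (rule orthogonal_if_norm_minimal)
    fix a
    have "w + a *\<^sub>C n \<in> N" using N(1) w(1) that by (simp add: subspace_add subspace_scale)
    from order_trans[OF le d_le[OF this]]
    show "norm (u - w) \<le> norm (u - w - a *\<^sub>C n)" by (simp add: diff_diff_eq)
  qed
  with w(1) show thesis by (rule that)
qed

text \<open>The closed sets \<open>E n\<close> cover the space, so by Baire one of them contains a
  ball. On that ball the functionals given by \<open>Y\<close> share one bound, which is then
  transferred to a ball around 0.\<close>

theorem uniform_boundedness:
  assumes compl: "complete (UNIV :: 'a set)"
    and ptw: "\<And>y. \<exists>C. \<forall>x\<in>Y. cmod (ip x y) \<le> C"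
  shows "bounded Y"
proof -
  define E where "E n = {y. \<forall>x\<in>Y. cmod (ip x y) \<le> real n}" for n
  have closed_E: "closed (E n)" for n
  proof -
    have "E n = (\<Inter>x\<in>Y. {y. cmod (ip x y) \<le> real n})" by (auto simp: E_def)
    moreover have "closed {y. cmod (ip x y) \<le> real n}" for x
      by (intro closed_Collect_le continuous_on_norm continuous_on_ip_right continuous_on_const)
    ultimately show ?thesis by (simp add: closed_INT)
  qed
  have "y \<in> \<Union>(range E)" for y
  proof -
    obtain C where C: "\<forall>x\<in>Y. cmod (ip x y) \<le> C" using ptw by blast
    obtain n where "C \<le> real n" using real_arch_simple by blast
    with C have "y \<in> E n" unfolding E_def by (auto intro: order_trans)
    thus ?thesis by blast
  qed
  hence "interior (\<Union>(range E)) \<noteq> {}"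
    by (metis UNIV_I UNIV_eq_I empty_iff interior_UNIV)
  then obtain n where "interior (E n) \<noteq> {}"
    using Met_TC.metric_Baire_category_alt[of "range E"] compl closed_E by auto
  then obtain y0 r where r: "r > 0" and sub: "cball y0 r \<subseteq> E n"
    by (meson all_not_in_conv mem_interior_cball)
  have "norm x \<le> 2 * real n / r" if x: "x \<in> Y" for x
  proof (cases "x = 0")
    case False
    \<comment> \<open>\<open>z\<close> has length \<open>r\<close> and points along
      \<open>x\<close>: \<open>y0 + z\<close> stays in the ball, and \<open>ip x z\<close> recovers
      \<open>r * norm x\<close> as a difference of two values bounded by \<open>n\<close>.\<close>
    define z where "z = (r / norm x) *\<^sub>R x"
    have "ip x z = complex_of_real (r / norm x) * ip x x"
      by (simp only: z_def ip_scale_right complex_cnj_complex_of_real flip: of_real_scale)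
    also have "\<dots> = complex_of_real (r * norm x)"
      using False by (simp add: ip_self power2_eq_square)
    finally have "cmod (ip x z) = r * norm x" using r by (simp add: norm_mult)
    moreover have "ip x z = ip x (y0 + z) - ip x y0" by (simp add: ip_add_right)
    moreover have "y0 + z \<in> E n" "y0 \<in> E n"
      using sub r False by (auto intro!: subsetD[OF sub] simp: z_def dist_norm)
    ultimately have "r * norm x \<le> real n + real n"
      using x norm_triangle_ineq4[of "ip x (y0 + z)" "ip x y0"] by (fastforce simp: E_def)
    thus ?thesis using r by (simp add: field_simps)
  qed (use r in simp)
  thus ?thesis unfolding bounded_iff by blast
qed

end


section \<open>Maximal uniformly definite subspaces\<close>

context fundamental_decomposition
begin

section \<open>The fundamental projections and the duality of the two summands\<close>

lemma proj_p_add: "proj_p (x + y) = proj_p x + proj_p y"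
proof -
  have "x + y = (proj_p x + proj_p y) + (proj_m x + proj_m y)"
    by (simp add: proj_m_def)
  thus ?thesis
    using proj_pI(1)[OF subspace_add[OF subspace_Hp proj_p_in proj_p_in]
        subspace_add[OF subspace_Hm proj_m_in proj_m_in], of x y x y] by simp
qed

lemma proj_p_scale: "proj_p (a *\<^sub>C x) = a *\<^sub>C proj_p x"
proof -
  have "a *\<^sub>C x = a *\<^sub>C proj_p x + a *\<^sub>C proj_m x"
    by (simp add: proj_m_def flip: scale_right_distrib)
  thus ?thesis
    using proj_pI(1)[OF subspace_scale[OF subspace_Hp proj_p_in]
        subspace_scale[OF subspace_Hm proj_m_in], of a x a x] by simp
qed

lemma proj_m_add: "proj_m (x + y) = proj_m x + proj_m y"
  by (simp add: proj_m_def proj_p_add)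

lemma proj_m_scale: "proj_m (a *\<^sub>C x) = a *\<^sub>C proj_m x"
  by (simp add: proj_m_def proj_p_scale scale_right_diff_distrib)

lemma zero_in_Hp: "0 \<in> Hp" and zero_in_Hm: "0 \<in> Hm"
  using subspace_Hp subspace_Hm by (simp_all add: subspace_0)

lemma proj_p_of_Hp: "p \<in> Hp \<Longrightarrow> proj_p p = p" and proj_m_of_Hp: "p \<in> Hp \<Longrightarrow> proj_m p = 0"
  using proj_pI[OF _ zero_in_Hm, of p] by simp_all

lemma hinner_add_left: "hinner (x + y) z = hinner x z + hinner y z"
  by (simp add: hinner_def proj_p_add proj_m_add form_add_left)

lemma hinner_scale_left: "hinner (a *\<^sub>C x) y = a * hinner x y"
  by (simp add: hinner_def proj_p_scale proj_m_scale form_scale_left algebra_simps)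

lemma hinner_hermitian: "hinner y x = cnj (hinner x y)"
  using form_hermitian[of "proj_p y" "proj_p x"] form_hermitian[of "proj_m y" "proj_m x"]
  by (simp add: hinner_def)

lemma form_zero_left: "form 0 x = 0"
  using form_scale_left[of 0 0 x] by simp

text \<open>Allows \<open>norm_eq_hinner\<close> to be squared: the square of \<open>sqrt t\<close>
  is \<open>t\<close> only for nonnegative \<open>t\<close>.\<close>

lemma Re_hinner_nonneg: "0 \<le> Re (hinner x x)"
proof -
  have "0 \<le> Re (form (proj_p x) (proj_p x))"
    using form_pos[OF proj_p_in, of x] form_zero_left by (cases "proj_p x = 0") auto
  moreover have "Re (form (proj_m x) (proj_m x)) \<le> 0"
    using form_neg[OF proj_m_in, of x] form_zero_left by (cases "proj_m x = 0") auto
  ultimately show ?thesis by (simp add: hinner_def)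
qed

text \<open>Duality device: facts about positive subspaces, read for the negated form with
  \<open>Hp\<close> and \<open>Hm\<close> exchanged, become facts about negative subspaces.\<close>

lemma fundamental_decomposition_uminus:
  "fundamental_decomposition scale (\<lambda>x y. - form x y) Hm Hp"
proof
  show "\<exists>p\<in>Hm. \<exists>m\<in>Hp. x = p + m" for x
    using decomp_ex[of x] by (metis add.commute)
  show "- form p m = 0" if "p \<in> Hm" "m \<in> Hp" for p m
    using decomp_orth[OF that(2,1)] form_hermitian[of p m] by simp
  show "- form y x = cnj (- form x y)" for x y
    using form_hermitian[of y x] by simp
  show "Hm \<inter> Hp = {0}"
    using decomp_direct by blast
qed (simp_all add: subspace_Hp subspace_Hm form_pos form_neg form_add_left form_scale_left)

text \<open>The sign change of the form cancels the exchange of the summands. Thus the norm, and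
  with it every topological notion, is the same on both sides of the duality.\<close>

lemma hinner_uminus:
  "fundamental_decomposition.hinner (\<lambda>x y. - form x y) Hm Hp = hinner"
proof -
  interpret dual: fundamental_decomposition scale "\<lambda>x y. - form x y" Hm Hp
    by (rule fundamental_decomposition_uminus)
  have p: "dual.proj_p x = proj_m x" for x
    using dual.proj_pI(1)[OF proj_m_in proj_p_in, of x x] by (metis add.commute proj_add)
  hence m: "dual.proj_m x = proj_p x" for x
    by (simp add: dual.proj_m_def proj_m_def)
  show ?thesis
    by (simp add: fun_eq_iff dual.hinner_def hinner_def p m)
qed

end

section \<open>The Krein space as a Hilbert space\<close>

sublocale krein_space \<subseteq> complex_inner_space scale hinner
proof
  show "Re (hinner x x) = (norm x)\<^sup>2" for x
    using norm_eq_hinner[of x] Re_hinner_nonneg[of x] by simp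
qed (rule hinner_add_left hinner_scale_left hinner_hermitian scale_of_real)+

context krein_space
begin

lemma krein_space_uminus: "krein_space scale (\<lambda>x y. - form x y) Hm Hp"
proof -
  interpret dual: fundamental_decomposition scale "\<lambda>x y. - form x y" Hm Hp
    by (rule fundamental_decomposition_uminus)
  show ?thesis
    by unfold_locales
      (simp_all add: complete_Hp complete_Hm separable scale_of_real hinner_uminus flip: norm_eq_hinner)
qed

lemma hinner_proj_p_proj_m: "hinner (proj_p x) (proj_m y) = 0"
proof -
  have "proj_p (proj_m y) = 0"
    using proj_pI(1)[OF zero_in_Hp proj_m_in, of y] by simp
  moreover have "form (proj_p x) 0 = 0"
    using decomp_orth[OF proj_p_in zero_in_Hm] .
  ultimately show ?thesis
    by (simp add: hinner_def proj_p_of_Hp proj_m_of_Hp proj_p_in form_zero_left)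
qed

lemma norm_sq_proj: "(norm x)\<^sup>2 = (norm (proj_p x))\<^sup>2 + (norm (proj_m x))\<^sup>2"
  using norm_add_sq[of "proj_p x" "proj_m x"] by (simp add: proj_add hinner_proj_p_proj_m)

text \<open>Turns definiteness into a comparison of the norms of the two components, the form in
  which it is used from here on.\<close>

lemma Re_form_self: "Re (form x x) = (norm (proj_p x))\<^sup>2 - (norm (proj_m x))\<^sup>2"
proof -
  have "hinner (proj_m x) (proj_p x) = 0"
    using hinner_hermitian[of "proj_m x" "proj_p x"] by (simp add: hinner_proj_p_proj_m)
  hence "form x x = hinner (proj_p x) (proj_p x) - hinner (proj_m x) (proj_m x)"
    unfolding form_eq_hinner[of x x] fundamental_symmetry_def
    using proj_add[of x] ip_add_right[of _ "proj_p x" "proj_m x"]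
    by (simp add: ip_diff_left hinner_proj_p_proj_m)
  thus ?thesis by (simp add: Re_ip_self)
qed

lemma norm_proj_p_le: "norm (proj_p x) \<le> norm x" and norm_proj_m_le: "norm (proj_m x) \<le> norm x"
  by (rule power2_le_imp_le; simp add: norm_sq_proj[of x])+

lemma bounded_linear_proj_p: "bounded_linear proj_p"
  by (rule bounded_linear_intro[where K = 1])
    (simp_all add: proj_p_add proj_p_scale norm_proj_p_le flip: scale_of_real)

lemma bounded_linear_proj_m: "bounded_linear proj_m"
  by (rule bounded_linear_intro[where K = 1])
    (simp_all add: proj_m_add proj_m_scale norm_proj_m_le flip: scale_of_real)

text \<open>The projections are bounded, so a Cauchy sequence splits into Cauchy sequences in the
  complete summands, and the two limits add up.\<close>

lemma complete_UNIV_krein: "complete (UNIV :: 'a set)"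
proof (rule completeI)
  fix X :: "nat \<Rightarrow> 'a" assume X: "Cauchy X"
  have "Cauchy (\<lambda>n. proj_p (X n))" "Cauchy (\<lambda>n. proj_m (X n))"
    using X by (auto intro: bounded_linear.Cauchy bounded_linear_proj_p bounded_linear_proj_m)
  then obtain p m where "(\<lambda>n. proj_p (X n)) \<longlonglongrightarrow> p" "(\<lambda>n. proj_m (X n)) \<longlonglongrightarrow> m"
    using completeE[OF complete_Hp] completeE[OF complete_Hm] proj_p_in proj_m_in by metis
  from tendsto_add[OF this] show "\<exists>l\<in>UNIV. X \<longlonglongrightarrow> l"
    by (auto simp: proj_add)
qed

section \<open>Maximal uniformly definite subspaces as graphs\<close>

lemma uniformly_pos_slope:
  assumes "uniformly_pos S"
  obtains k where "0 \<le> k" "k < 1" "\<And>x. x \<in> S \<Longrightarrow> norm (proj_m x) \<le> k * norm (proj_p x)"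
proof -
  obtain \<beta> where \<beta>: "\<beta> > 0" "\<And>x. x \<in> S \<Longrightarrow> \<beta> * (norm x)\<^sup>2 \<le> Re (form x x)"
    using assms unfolding uniformly_pos_def by blast
  \<comment> \<open>Shrinking the constant to at most 1 keeps the radicand of \<open>k\<close>
    nonnegative. The value of \<open>k\<close> comes from solving \<alpha> (p^2 + m^2) \<le> p^2 -
    m^2 for m / p, where p and m are the norms of the components.\<close>
  define \<alpha> where "\<alpha> = min \<beta> 1"
  have \<alpha>: "0 < \<alpha>" "\<alpha> \<le> 1" using \<beta>(1) by (auto simp: \<alpha>_def)
  define k where "k = sqrt ((1 - \<alpha>) / (1 + \<alpha>))"
  have "norm (proj_m x) \<le> k * norm (proj_p x)" if "x \<in> S" for x
  proof -
    have "\<alpha> * (norm x)\<^sup>2 \<le> \<beta> * (norm x)\<^sup>2" by (intro mult_right_mono) (auto simp: \<alpha>_def)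
    also note \<beta>(2)[OF that]
    finally have "(1 + \<alpha>) * (norm (proj_m x))\<^sup>2 \<le> (1 - \<alpha>) * (norm (proj_p x))\<^sup>2"
      by (simp add: norm_sq_proj[of x] Re_form_self algebra_simps)
    hence "(norm (proj_m x))\<^sup>2 \<le> (1 - \<alpha>) / (1 + \<alpha>) * (norm (proj_p x))\<^sup>2"
      using \<alpha> by (simp add: field_simps)
    also have "\<dots> = (k * norm (proj_p x))\<^sup>2"
      using \<alpha> by (simp add: k_def power_mult_distrib)
    finally show ?thesis
      by (rule power2_le_imp_le) (use \<alpha> in \<open>simp add: k_def\<close>)
  qed
  moreover have "0 \<le> k" "k < 1" using \<alpha> by (auto simp: k_def)
  ultimately show thesis using that by blast
qed

text \<open>Both sides of the defining inequality are continuous, so the closure is uniformly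
  positive with the same constant, and maximality leaves nothing to add.\<close>

lemma max_uniformly_pos_closed:
  assumes "max_uniformly_pos M"
  shows "closed M"
proof -
  obtain \<alpha> where \<alpha>: "\<alpha> > 0" "\<And>x. x \<in> M \<Longrightarrow> \<alpha> * (norm x)\<^sup>2 \<le> Re (form x x)"
    and M: "subspace M"
    using assms unfolding max_uniformly_pos_def uniformly_pos_def by blast
  have "closed {x. \<alpha> * (norm x)\<^sup>2 \<le> Re (form x x)}"
    unfolding Re_form_self
    by (intro closed_Collect_le continuous_intros linear_continuous_on
        bounded_linear_proj_p bounded_linear_proj_m)
  hence "closure M \<subseteq> {x. \<alpha> * (norm x)\<^sup>2 \<le> Re (form x x)}"
    using \<alpha>(2) by (intro closure_minimal) auto
  hence "uniformly_pos (closure M)"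
    using \<alpha>(1) subspace_closure[OF M] unfolding uniformly_pos_def by blast
  hence "closure M = M"
    using assms closure_subset unfolding max_uniformly_pos_def by blast
  thus ?thesis by (metis closed_closure)
qed

lemma max_uniformly_pos_graph:
  assumes M: "max_uniformly_pos M" and p: "p \<in> Hp"
  shows "\<exists>m\<in>Hm. p + m \<in> M"
proof -
  have sub: "subspace M" and upos: "uniformly_pos M"
    using M unfolding max_uniformly_pos_def uniformly_pos_def by auto
  obtain \<beta> where \<beta>: "\<beta> > 0" "\<And>x. x \<in> M \<Longrightarrow> \<beta> * (norm x)\<^sup>2 \<le> Re (form x x)"
    using upos unfolding uniformly_pos_def by blast
  obtain k where k: "0 \<le> k" "k < 1" "\<And>x. x \<in> M \<Longrightarrow> norm (proj_m x) \<le> k * norm (proj_p x)"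
    using uniformly_pos_slope[OF upos] by blast
  define N where "N = proj_p ` M"
  have "subspace N"
    unfolding N_def
  proof (rule subspaceI)
    show "0 \<in> proj_p ` M"
      using subspace_0[OF sub] proj_p_of_Hp[OF zero_in_Hp] by force
  next
    fix x y assume "x \<in> proj_p ` M" "y \<in> proj_p ` M"
    thus "x + y \<in> proj_p ` M" using subspace_add[OF sub] by (auto simp flip: proj_p_add)
  next
    fix a x assume "x \<in> proj_p ` M"
    thus "a *\<^sub>C x \<in> proj_p ` M" using subspace_scale[OF sub] by (auto simp flip: proj_p_scale)
  qed
  \<comment> \<open>On \<open>M\<close> the slope is below 1, so \<open>norm x\<close> is at most
    twice \<open>norm (proj_p x)\<close>. This is the lower bound 1/2 under which the image of the
    complete \<open>M\<close> is complete.\<close>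
  moreover have "complete N"
    unfolding N_def
  proof (rule complete_isometric_image[where e = "1/2"])
    show "Real_Vector_Spaces.subspace M"
      using sub subspace_scale[OF sub, of _ "complex_of_real _"]
      by (auto simp: real_vector.subspace_def subspace_0 subspace_add of_real_scale)
    show "\<forall>x\<in>M. 1/2 * norm x \<le> norm (proj_p x)"
    proof
      fix x assume "x \<in> M"
      have "norm x \<le> norm (proj_p x) + norm (proj_m x)"
        by (metis norm_triangle_ineq proj_add)
      also have "norm (proj_m x) \<le> 1 * norm (proj_p x)"
        using k(3)[OF \<open>x \<in> M\<close>] k(2) by (meson less_imp_le mult_right_mono norm_ge_zero order_trans)
      finally show "1/2 * norm x \<le> norm (proj_p x)" by simp
    qed
    show "complete M"
      using complete_Int_closed[OF complete_UNIV_krein max_uniformly_pos_closed[OF M]] by simp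
  qed (simp_all add: bounded_linear_proj_p)
  ultimately obtain w where w: "w \<in> N" and orth: "\<And>n. n \<in> N \<Longrightarrow> hinner (p - w) n = 0"
    using projection by blast
  define v where "v = p - w"
  have v: "v \<in> Hp" using w p subspace_diff[OF subspace_Hp] proj_p_in by (auto simp: v_def N_def)
  \<comment> \<open>The competitor to \<open>M\<close>: the span of \<open>M\<close> and the part
    \<open>v\<close> of \<open>p\<close> orthogonal to \<open>N\<close>.\<close>
  define S where "S = {x + y | x y. x \<in> M \<and> y \<in> range (\<lambda>a. a *\<^sub>C v)}"
  have "subspace S"
    unfolding S_def by (intro subspace_sums sub) (metis span_singleton subspace_span)
  \<comment> \<open>\<open>v\<close> lies in \<open>Hp\<close> and is orthogonal to
    \<open>proj_p x\<close>, so there are no cross terms. The constant is \<beta> on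
    \<open>M\<close> and 1 on multiples of \<open>v\<close>, whence the minimum.\<close>
  moreover have "min \<beta> 1 * (norm z)\<^sup>2 \<le> Re (form z z)" if "z \<in> S" for z
  proof -
    obtain x a where x: "x \<in> M" and z: "z = x + a *\<^sub>C v" using \<open>z \<in> S\<close> by (auto simp: S_def)
    have "hinner v (proj_p x) = 0" using orth x by (auto simp: v_def N_def)
    hence "hinner (proj_p x) (a *\<^sub>C v) = 0"
      using hinner_hermitian[of "proj_p x" v] by (simp add: ip_scale_right)
    hence pz: "(norm (proj_p z))\<^sup>2 = (norm (proj_p x))\<^sup>2 + (norm (a *\<^sub>C v))\<^sup>2"
      using norm_add_sq[of "proj_p x" "a *\<^sub>C v"]
      by (simp add: z proj_p_add proj_p_scale proj_p_of_Hp[OF v])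
    have mz: "proj_m z = proj_m x"
      by (simp add: z proj_m_add proj_m_scale proj_m_of_Hp[OF v])
    have "min \<beta> 1 * (norm z)\<^sup>2 = min \<beta> 1 * (norm x)\<^sup>2 + min \<beta> 1 * (norm (a *\<^sub>C v))\<^sup>2"
      unfolding norm_sq_proj[of z] norm_sq_proj[of x] pz mz by (simp add: algebra_simps)
    also have "\<dots> \<le> \<beta> * (norm x)\<^sup>2 + 1 * (norm (a *\<^sub>C v))\<^sup>2"
      by (intro add_mono mult_right_mono) auto
    also have "\<dots> \<le> Re (form x x) + (norm (a *\<^sub>C v))\<^sup>2"
      using \<beta>(2)[OF x] by simp
    also have "\<dots> = Re (form z z)"
      unfolding Re_form_self pz mz by simp
    finally show ?thesis .
  qed
  ultimately have "uniformly_pos S"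
    using \<beta>(1) unfolding uniformly_pos_def by (intro conjI exI[of _ "min \<beta> 1"]) auto
  moreover have "M \<subseteq> S"
  proof
    fix x assume "x \<in> M"
    moreover have "x = x + 0 *\<^sub>C v" by simp
    ultimately show "x \<in> S" unfolding S_def by blast
  qed
  ultimately have "S = M" using M unfolding max_uniformly_pos_def by blast
  moreover have "v \<in> S"
  proof -
    have "v = 0 + 1 *\<^sub>C v" by simp
    thus ?thesis using subspace_0[OF sub] unfolding S_def by blast
  qed
  \<comment> \<open>Now \<open>v\<close> lies in \<open>N\<close> and is also orthogonal to
    \<open>N\<close>, so it vanishes and \<open>p\<close> itself belongs to
    \<open>N\<close>.\<close>
  ultimately have "proj_p v \<in> N" by (simp add: N_def)
  hence "hinner v v = 0" using orth by (simp add: v_def[symmetric] proj_p_of_Hp[OF v])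
  hence "p = w" using ip_self[of v] by (simp add: v_def)
  then obtain x where "x \<in> M" "p = proj_p x" using w by (auto simp: N_def)
  thus ?thesis using proj_m_in[of x] proj_add[of x] by metis
qed

text \<open>Makes the slope and graph lemmas available for maximal negative subspaces.\<close>

lemma max_uniformly_pos_uminus:
  "krein_space.max_uniformly_pos scale (\<lambda>x y. - form x y) = max_uniformly_neg"
proof -
  interpret dual: krein_space scale "\<lambda>x y. - form x y" Hm Hp
    by (rule krein_space_uminus)
  have "dual.uniformly_pos = uniformly_neg"
    by (auto simp: fun_eq_iff dual.uniformly_pos_def uniformly_neg_def) force+
  thus ?thesis
    by (simp add: fun_eq_iff dual.max_uniformly_pos_def max_uniformly_neg_def)
qed


lemma max_uniform_sum:
  assumes P: "max_uniformly_pos P" and N: "max_uniformly_neg N"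
  shows "\<exists>x\<in>P. \<exists>y\<in>N. z = x + y"
proof -
  interpret dual: krein_space scale "\<lambda>x y. - form x y" Hm Hp
    by (rule krein_space_uminus)
  have N': "dual.max_uniformly_pos N" using N by (simp only: max_uniformly_pos_uminus)
  have dual_p: "dual.proj_p x = proj_m x" and dual_m: "dual.proj_m x = proj_p x" for x
    using dual.proj_pI[OF proj_m_in proj_p_in, of x x] by (metis add.commute proj_add)+
  have sub: "subspace P" "subspace N"
    using P N by (auto simp: max_uniformly_pos_def max_uniformly_neg_def uniformly_pos_def uniformly_neg_def)
  obtain k where k: "0 \<le> k" "k < 1" "\<And>x. x \<in> P \<Longrightarrow> norm (proj_m x) \<le> k * norm (proj_p x)"
    using P uniformly_pos_slope unfolding max_uniformly_pos_def by blast
  obtain l where l: "0 \<le> l" "l < 1" "\<And>x. x \<in> N \<Longrightarrow> norm (proj_p x) \<le> l * norm (proj_m x)"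
    using N' dual.uniformly_pos_slope unfolding dual.max_uniformly_pos_def dual_p dual_m by metis
  obtain K where K: "\<And>p. p \<in> Hp \<Longrightarrow> K p \<in> Hm" "\<And>p. p \<in> Hp \<Longrightarrow> p + K p \<in> P"
    using max_uniformly_pos_graph[OF P] by metis
  obtain L where L: "\<And>m. m \<in> Hm \<Longrightarrow> L m \<in> Hp" "\<And>m. m \<in> Hm \<Longrightarrow> m + L m \<in> N"
    using dual.max_uniformly_pos_graph[OF N'] by metis
  \<comment> \<open>\<open>K\<close> is just a choice function. The slope bound, applied to the
    difference of two points of \<open>P\<close>, makes it Lipschitz without first showing it
    linear.\<close>
  have K_lip: "norm (K p - K q) \<le> k * norm (p - q)" if "p \<in> Hp" "q \<in> Hp" for p q
  proof -
    have "p - q \<in> Hp" "K p - K q \<in> Hm"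
      using that K by (auto intro: subspace_diff subspace_Hp subspace_Hm)
    moreover have "(p - q) + (K p - K q) \<in> P"
      using subspace_diff[OF sub(1) K(2)[OF that(1)] K(2)[OF that(2)]] by (simp add: algebra_simps)
    ultimately show ?thesis using k(3) proj_pI by metis
  qed
  have L_lip: "norm (L m - L n) \<le> l * norm (m - n)" if "m \<in> Hm" "n \<in> Hm" for m n
  proof -
    have "m - n \<in> Hm" "L m - L n \<in> Hp"
      using that L by (auto intro: subspace_diff subspace_Hp subspace_Hm)
    moreover have "(L m - L n) + (m - n) \<in> N"
      using subspace_diff[OF sub(2) L(2)[OF that(1)] L(2)[OF that(2)]] by (simp add: algebra_simps)
    ultimately show ?thesis using l(3) proj_pI by metis
  qed
  \<comment> \<open>Comparing components in \<open>z = (a + K a) + (b + L b)\<close> gives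
    \<open>a + L b = proj_p z\<close> and \<open>b + K a = proj_m z\<close>. Eliminating
    \<open>b\<close> leaves the fixed point equation of \<open>F\<close>, whose contraction constant
    is the product of the slopes.\<close>
  define F where "F a = proj_p z - L (proj_m z - K a)" for a
  have in_Hm: "proj_m z - K a \<in> Hm" if "a \<in> Hp" for a
    using that K by (auto intro: subspace_diff subspace_Hm proj_m_in)
  have "\<exists>!a\<in>Hp. F a = a"
  proof (rule Banach_fix)
    show "complete Hp" by (rule complete_Hp)
    show "Hp \<noteq> {}" using zero_in_Hp by blast
    show "0 \<le> l * k" using k l by simp
    show "l * k < 1" using k l by (meson le_less_trans less_imp_le mult_left_le)
    show "F ` Hp \<subseteq> Hp"
      using L(1) in_Hm by (auto simp: F_def intro!: subspace_diff subspace_Hp proj_p_in)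
  next
    fix a b assume ab: "a \<in> Hp" "b \<in> Hp"
    have "dist (F a) (F b) = norm (L (proj_m z - K a) - L (proj_m z - K b))"
      by (simp add: F_def dist_norm norm_minus_commute)
    also have "\<dots> \<le> l * norm (K a - K b)"
      using L_lip[OF in_Hm[OF ab(1)] in_Hm[OF ab(2)]] by (simp add: norm_minus_commute)
    also have "\<dots> \<le> l * (k * norm (a - b))"
      using K_lip[OF ab] l(1) by (rule mult_left_mono)
    finally show "dist (F a) (F b) \<le> l * k * dist a b" by (simp add: dist_norm mult.assoc)
  qed
  then obtain a where a: "a \<in> Hp" "F a = a" by blast
  define b where "b = proj_m z - K a"
  have "(a + K a) + (b + L b) = z"
    using a(2) proj_add[of z] by (simp add: F_def b_def algebra_simps)
  moreover have "b + L b \<in> N" using L(2) in_Hm a(1) by (simp add: b_def)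
  ultimately show ?thesis using K(2)[OF a(1)] by metis
qed

end

section \<open>Synthesis operators of Bessel families\<close>

lemma ell2_summable: "c \<in> ell2 I \<Longrightarrow> (\<lambda>i. (cmod (c i))\<^sup>2) summable_on I"
  by (simp add: ell2_def)

lemma ell2_add:
  assumes "c \<in> ell2 I" "d \<in> ell2 I"
  shows "(\<lambda>i. c i + d i) \<in> ell2 I"
proof -
  have "(\<lambda>i. 2 * (cmod (c i))\<^sup>2 + 2 * (cmod (d i))\<^sup>2) summable_on I"
    using assms by (intro summable_on_add summable_on_cmult_right ell2_summable)
  moreover have "(cmod (c i + d i))\<^sup>2 \<le> 2 * (cmod (c i))\<^sup>2 + 2 * (cmod (d i))\<^sup>2" for i
  proof -
    have "(cmod (c i + d i))\<^sup>2 \<le> (cmod (c i) + cmod (d i))\<^sup>2"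
      by (simp add: norm_triangle_ineq power_mono)
    also have "\<dots> \<le> 2 * (cmod (c i))\<^sup>2 + 2 * (cmod (d i))\<^sup>2"
      using zero_le_power2[of "cmod (c i) - cmod (d i)"] by (simp add: power2_sum power2_diff)
    finally show ?thesis .
  qed
  ultimately have "(\<lambda>i. (cmod (c i + d i))\<^sup>2) summable_on I"
    by (rule summable_on_comparison_test) auto
  thus ?thesis using assms by (simp add: ell2_def)
qed

lemma ell2_scale:
  assumes "c \<in> ell2 I"
  shows "(\<lambda>i. a * c i) \<in> ell2 I"
  using summable_on_cmult_right[OF ell2_summable[OF assms], of "(cmod a)\<^sup>2"] assms
  by (simp add: ell2_def norm_mult power_mult_distrib)

lemma ell2_unit_in: "i \<in> I \<Longrightarrow> ell2_unit i \<in> ell2 I"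
proof -
  assume "i \<in> I"
  have "((\<lambda>j. (cmod (ell2_unit i j))\<^sup>2) has_sum 1) I
      \<longleftrightarrow> ((\<lambda>j. (cmod (ell2_unit i j))\<^sup>2) has_sum 1) {i}"
    using \<open>i \<in> I\<close> by (intro has_sum_cong_neutral) (auto simp: ell2_unit_def)
  hence "(\<lambda>j. (cmod (ell2_unit i j))\<^sup>2) summable_on I"
    by (auto simp: summable_on_def ell2_unit_def intro!: has_sum_finiteI)
  thus ?thesis using \<open>i \<in> I\<close> by (auto simp: ell2_def ell2_unit_def)
qed

lemma ell2_proj_in:
  assumes "K \<subseteq> I" "c \<in> ell2 I"
  shows "ell2_proj K c \<in> ell2 I"
proof -
  have "(\<lambda>i. (cmod (ell2_proj K c i))\<^sup>2) summable_on I"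
    using ell2_summable[OF assms(2)] by (rule summable_on_comparison_test) (auto simp: ell2_proj_def)
  thus ?thesis using assms by (auto simp: ell2_def ell2_proj_def)
qed

lemma L2_set_le_ell2_norm:
  assumes "c \<in> ell2 I" "finite F" "F \<subseteq> I"
  shows "L2_set (\<lambda>i. cmod (c i)) F \<le> ell2_norm I c"
  unfolding L2_set_def ell2_norm_def
  using assms by (intro real_sqrt_le_mono finite_sum_le_infsum ell2_summable) auto

lemma ell2_small_tails:
  assumes "c \<in> ell2 I" "e > 0"
  shows "\<exists>F0. finite F0 \<and> F0 \<subseteq> I \<and> (\<forall>F. finite F \<and> F \<subseteq> I - F0 \<longrightarrow> L2_set (\<lambda>i. cmod (c i)) F < e)"
proof -
  let ?g = "\<lambda>i. (cmod (c i))\<^sup>2"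
  note S = ell2_summable[OF assms(1)]
  \<comment> \<open>A partial sum within \<open>e\<^sup>2 / 2\<close> of the total leaves less than
    \<open>e\<^sup>2\<close> to any finite set disjoint from \<open>F0\<close>.\<close>
  obtain F0 where F0: "finite F0" "F0 \<subseteq> I" "dist (sum ?g F0) (infsum ?g I) \<le> e\<^sup>2 / 2"
    using has_sum_finite_approximation[OF has_sum_infsum[OF S], of "e\<^sup>2 / 2"] assms(2) by auto
  have "L2_set (\<lambda>i. cmod (c i)) F < e" if F: "finite F" "F \<subseteq> I - F0" for F
  proof -
    have "sum ?g F0 + sum ?g F = sum ?g (F0 \<union> F)"
      using F F0 by (subst sum.union_disjoint) auto
    also have "\<dots> \<le> infsum ?g I"
      using F F0 by (intro finite_sum_le_infsum S) auto
    finally have "sum ?g F < e\<^sup>2"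
      using F0(3) zero_less_power[OF assms(2), of 2] unfolding dist_real_def by linarith
    thus ?thesis using assms(2) by (simp add: L2_set_def real_less_lsqrt sum_nonneg)
  qed
  thus ?thesis using F0 by blast
qed

text \<open>Cauchy-Schwarz for finite coefficient vectors. It gives both the norm bound for finite
  sums and, in the limit, the estimate for the synthesis operator.\<close>

lemma (in complex_inner_space) cmod_ip_finite_sum_le:
  "cmod (ip x (\<Sum>i\<in>F. c i *\<^sub>C f i)) \<le> L2_set (\<lambda>i. cmod (c i)) F * L2_set (\<lambda>i. cmod (ip x (f i))) F"
proof -
  have "cmod (ip x (\<Sum>i\<in>F. c i *\<^sub>C f i)) \<le> (\<Sum>i\<in>F. \<bar>cmod (c i)\<bar> * \<bar>cmod (ip x (f i))\<bar>)"
    unfolding ip_sum_right by (rule sum_norm_le) (simp add: ip_scale_right norm_mult)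
  also note L2_set_mult_ineq
  finally show ?thesis .
qed

section \<open>The synthesis operator as an unconditionally convergent series\<close>

context krein_space
begin

lemma bessel_bound:
  assumes "bessel_family I f"
  obtains B where "B > 0"
    "\<And>x. (\<lambda>i. (cmod (hinner x (f i)))\<^sup>2) summable_on I"
    "\<And>x. (\<Sum>\<^sub>\<infinity>i\<in>I. (cmod (hinner x (f i)))\<^sup>2) \<le> B * (norm x)\<^sup>2"
proof -
  obtain B where B: "\<And>x. (\<lambda>i. (cmod (hinner x (f i)))\<^sup>2) summable_on I"
    "\<And>x. (\<Sum>\<^sub>\<infinity>i\<in>I. (cmod (hinner x (f i)))\<^sup>2) \<le> B * (norm x)\<^sup>2"
    using assms unfolding bessel_family_def by blast
  \<comment> \<open>The constant in \<open>bessel_family\<close> has no prescribed sign; the maximum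
    with 1 makes it positive.\<close>
  have "(\<Sum>\<^sub>\<infinity>i\<in>I. (cmod (hinner x (f i)))\<^sup>2) \<le> max B 1 * (norm x)\<^sup>2" for x
    by (rule order_trans[OF B(2)]) (simp add: mult_right_mono)
  with B(1) show thesis by (intro that[of "max B 1"]) auto
qed

lemma L2_set_hinner_le:
  assumes "bessel_family I f" "finite F" "F \<subseteq> I"
  shows "L2_set (\<lambda>i. cmod (hinner x (f i))) F \<le> sqrt (\<Sum>\<^sub>\<infinity>i\<in>I. (cmod (hinner x (f i)))\<^sup>2)"
  unfolding L2_set_def
  using assms by (intro real_sqrt_le_mono finite_sum_le_infsum) (auto simp: bessel_family_def)

text \<open>Pairing the finite sum \<open>y\<close> with itself bounds its squared norm by the norm
  of the coefficients times \<open>sqrt B * norm y\<close>; one factor \<open>norm y\<close>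
  cancels.\<close>

lemma bessel_finite_sum_bound:
  assumes "bessel_family I f"
  obtains K where "K > 0"
    "\<And>F c. finite F \<Longrightarrow> F \<subseteq> I \<Longrightarrow> norm (\<Sum>i\<in>F. c i *\<^sub>C f i) \<le> K * L2_set (\<lambda>i. cmod (c i)) F"
proof -
  obtain B where B: "B > 0"
    "\<And>x. (\<Sum>\<^sub>\<infinity>i\<in>I. (cmod (hinner x (f i)))\<^sup>2) \<le> B * (norm x)\<^sup>2"
    using bessel_bound[OF assms] by metis
  have "norm (\<Sum>i\<in>F. c i *\<^sub>C f i) \<le> sqrt B * L2_set (\<lambda>i. cmod (c i)) F"
    if F: "finite F" "F \<subseteq> I" for F c
  proof -
    define y where "y = (\<Sum>i\<in>F. c i *\<^sub>C f i)"
    have "L2_set (\<lambda>i. cmod (hinner y (f i))) F \<le> sqrt B * norm y"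
      using order_trans[OF L2_set_hinner_le[OF assms F] real_sqrt_le_mono[OF B(2)]]
      by (simp add: real_sqrt_mult)
    hence "L2_set (\<lambda>i. cmod (c i)) F * L2_set (\<lambda>i. cmod (hinner y (f i))) F
        \<le> L2_set (\<lambda>i. cmod (c i)) F * (sqrt B * norm y)"
      by (intro mult_left_mono) auto
    hence "cmod (hinner y y) \<le> L2_set (\<lambda>i. cmod (c i)) F * (sqrt B * norm y)"
      using cmod_ip_finite_sum_le[of y c f F] unfolding y_def[symmetric] by linarith
    hence "norm y * norm y \<le> (sqrt B * L2_set (\<lambda>i. cmod (c i)) F) * norm y"
      by (simp add: ip_self norm_power power2_eq_square norm_mult mult_ac)
    thus ?thesis
      unfolding y_def[symmetric] using B(1)
      by (cases "y = 0") (auto dest: mult_right_le_imp_le)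
  qed
  with B(1) show thesis by (intro that[of "sqrt B"]) auto
qed

lemma bessel_summable:
  assumes "bessel_family I f" "c \<in> ell2 I"
  shows "(\<lambda>i. c i *\<^sub>C f i) summable_on I"
proof (rule summable_on_if_small_tails[OF complete_UNIV_krein])
  fix e :: real assume "e > 0"
  obtain K where K: "K > 0" "\<And>F c. finite F \<Longrightarrow> F \<subseteq> I \<Longrightarrow>
      norm (\<Sum>i\<in>F. c i *\<^sub>C f i) \<le> K * L2_set (\<lambda>i. cmod (c i)) F"
    using bessel_finite_sum_bound[OF assms(1)] by metis
  obtain F0 where F0: "finite F0" "F0 \<subseteq> I"
    "\<And>F. finite F \<Longrightarrow> F \<subseteq> I - F0 \<Longrightarrow> L2_set (\<lambda>i. cmod (c i)) F < e / K"
    using ell2_small_tails[OF assms(2), of "e / K"] \<open>e > 0\<close> K(1) by (metis divide_pos_pos)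
  have "norm (\<Sum>i\<in>F. c i *\<^sub>C f i) < e" if "finite F" "F \<subseteq> I - F0" for F
  proof -
    have "norm (\<Sum>i\<in>F. c i *\<^sub>C f i) \<le> K * L2_set (\<lambda>i. cmod (c i)) F"
      using that by (intro K(2)) auto
    also have "\<dots> < K * (e / K)"
      using F0(3)[OF that] K(1) by (rule mult_strict_left_mono)
    finally show ?thesis using K(1) by simp
  qed
  thus "\<exists>F0. finite F0 \<and> F0 \<subseteq> I \<and>
      (\<forall>F. finite F \<and> F \<subseteq> I - F0 \<longrightarrow> norm (\<Sum>i\<in>F. c i *\<^sub>C f i) < e)"
    using F0(1,2) by blast
qed

text \<open>Comparing \<open>T c\<close> with \<open>T\<close> of a finite truncation of \<open>c\<close> shows that \<open>T\<close> is determined by its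
  values on the unit vectors.\<close>

lemma bounded_ell2_operator_has_sum:
  assumes T: "bounded_ell2_operator I T" "\<And>i. i \<in> I \<Longrightarrow> T (ell2_unit i) = f i"
    and c: "c \<in> ell2 I"
  shows "((\<lambda>i. c i *\<^sub>C f i) has_sum T c) I"
proof -
  have add: "T (\<lambda>i. c i + d i) = T c + T d" if "c \<in> ell2 I" "d \<in> ell2 I" for c d
    using T(1) that unfolding bounded_ell2_operator_def by blast
  have scale: "T (\<lambda>i. a * c i) = a *\<^sub>C T c" if "c \<in> ell2 I" for a c
    using T(1) that unfolding bounded_ell2_operator_def by blast
  obtain K where K: "\<And>c. c \<in> ell2 I \<Longrightarrow> norm (T c) \<le> K * ell2_norm I c"
    using T(1) unfolding bounded_ell2_operator_def by blast
  have fin: "T (ell2_proj F c) = (\<Sum>i\<in>F. c i *\<^sub>C f i)" if "finite F" "F \<subseteq> I" for F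
    using that
  proof (induction F)
    case empty
    \<comment> \<open>The zero sequence is written as a multiple of \<open>c\<close>, so that
      homogeneity of \<open>T\<close> evaluates it.\<close>
    have "ell2_proj {} c = (\<lambda>i. 0 * c i)" by (simp add: ell2_proj_def)
    thus ?case using scale[OF c, of 0] by simp
  next
    case (insert j F)
    have "ell2_proj (insert j F) c = (\<lambda>i. c j * ell2_unit j i + ell2_proj F c i)"
      using insert.hyps by (auto simp: ell2_proj_def ell2_unit_def fun_eq_iff)
    thus ?case
      using insert c by (simp add: add scale ell2_scale ell2_unit_in ell2_proj_in T(2))
  qed
  let ?g = "\<lambda>i. (cmod (c i))\<^sup>2"
  note S = ell2_summable[OF c]
  have diff: "norm ((\<Sum>i\<in>F. c i *\<^sub>C f i) - T c) \<le> K * sqrt (infsum ?g I - sum ?g F)"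
    if F: "finite F" "F \<subseteq> I" for F
  proof -
    have "c = (\<lambda>i. ell2_proj F c i + ell2_proj (I - F) c i)"
      using c F by (auto simp: ell2_proj_def ell2_def fun_eq_iff)
    hence "T c = T (ell2_proj F c) + T (ell2_proj (I - F) c)"
      using add[OF ell2_proj_in ell2_proj_in] F c by (metis Diff_subset)
    hence "norm ((\<Sum>i\<in>F. c i *\<^sub>C f i) - T c) = norm (T (ell2_proj (I - F) c))"
      using fin[OF F] by simp
    also have "\<dots> \<le> K * ell2_norm I (ell2_proj (I - F) c)"
      using c by (intro K ell2_proj_in) auto
    also have "(\<Sum>\<^sub>\<infinity>i\<in>I. (cmod (ell2_proj (I - F) c i))\<^sup>2) = infsum ?g (I - F)"
      by (rule infsum_cong_neutral) (auto simp: ell2_proj_def)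
    hence "ell2_norm I (ell2_proj (I - F) c) = sqrt (infsum ?g I - sum ?g F)"
      using F S by (simp add: ell2_norm_def infsum_Diff)
    finally show ?thesis .
  qed
  have "((\<lambda>F. K * sqrt (infsum ?g I - sum ?g F)) \<longlongrightarrow> K * sqrt (infsum ?g I - infsum ?g I))
      (finite_subsets_at_top I)"
    by (intro tendsto_intros infsum_tendsto S)
  hence "((\<lambda>F. K * sqrt (infsum ?g I - sum ?g F)) \<longlongrightarrow> 0) (finite_subsets_at_top I)"
    by simp
  hence "((\<lambda>F. (\<Sum>i\<in>F. c i *\<^sub>C f i) - T c) \<longlongrightarrow> 0) (finite_subsets_at_top I)"
    by (rule Lim_null_comparison[rotated]) (auto intro!: eventually_finite_subsets_at_top_weakI diff)
  thus ?thesis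
    unfolding has_sum_def by (simp add: LIM_zero_iff)
qed

lemma bessel_series_bounded_ell2_operator:
  assumes "bessel_family I f"
  shows "bounded_ell2_operator I (\<lambda>c. if c \<in> ell2 I then \<Sum>\<^sub>\<infinity>i\<in>I. c i *\<^sub>C f i else 0)"
proof -
  note S = has_sum_infsum[OF bessel_summable[OF assms]]
  obtain K where K: "K > 0" "\<And>F c. finite F \<Longrightarrow> F \<subseteq> I \<Longrightarrow>
      norm (\<Sum>i\<in>F. c i *\<^sub>C f i) \<le> K * L2_set (\<lambda>i. cmod (c i)) F"
    using bessel_finite_sum_bound[OF assms] by metis
  have "norm (\<Sum>\<^sub>\<infinity>i\<in>I. c i *\<^sub>C f i) \<le> K * ell2_norm I c" if c: "c \<in> ell2 I" for c
  proof (rule tendsto_upperbound)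
    show "((\<lambda>F. norm (\<Sum>i\<in>F. c i *\<^sub>C f i)) \<longlongrightarrow> norm (\<Sum>\<^sub>\<infinity>i\<in>I. c i *\<^sub>C f i)) (finite_subsets_at_top I)"
      using S[OF c] unfolding has_sum_def by (rule tendsto_norm)
    have "norm (\<Sum>i\<in>F. c i *\<^sub>C f i) \<le> K * ell2_norm I c" if "finite F" "F \<subseteq> I" for F
      using order_trans[OF K(2)[OF that] mult_left_mono[OF L2_set_le_ell2_norm[OF c that]]] K(1)
      by simp
    thus "\<forall>\<^sub>F F in finite_subsets_at_top I. norm (\<Sum>i\<in>F. c i *\<^sub>C f i) \<le> K * ell2_norm I c"
      by (rule eventually_finite_subsets_at_top_weakI)
  qed simp
  moreover have "(\<Sum>\<^sub>\<infinity>i\<in>I. (c i + d i) *\<^sub>C f i) = (\<Sum>\<^sub>\<infinity>i\<in>I. c i *\<^sub>C f i) + (\<Sum>\<^sub>\<infinity>i\<in>I. d i *\<^sub>C f i)"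
    if "c \<in> ell2 I" "d \<in> ell2 I" for c d
    using has_sum_add[OF S[OF that(1)] S[OF that(2)]]
    by (intro infsumI) (simp add: scale_left_distrib)
  moreover have "(\<Sum>\<^sub>\<infinity>i\<in>I. (a * c i) *\<^sub>C f i) = a *\<^sub>C (\<Sum>\<^sub>\<infinity>i\<in>I. c i *\<^sub>C f i)" if "c \<in> ell2 I" for a c
    using has_sum_bounded_linear[OF bounded_linear_scale S[OF that], of a]
    by (intro infsumI) (simp add: o_def)
  ultimately show ?thesis
    unfolding bounded_ell2_operator_def by (auto simp: ell2_add ell2_scale)
qed

text \<open>Resolves the \<open>THE\<close> in \<open>synthesis\<close>: the series is one such
  operator, and \<open>bounded_ell2_operator_has_sum\<close> forces the same value on any other. Off
  \<open>ell2 I\<close> both are 0 by convention.\<close>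

lemma synthesis_eq:
  assumes "bessel_family I f"
  shows "synthesis I f = (\<lambda>c. if c \<in> ell2 I then \<Sum>\<^sub>\<infinity>i\<in>I. c i *\<^sub>C f i else 0)" (is "_ = ?T")
  unfolding synthesis_def
proof (rule the_equality)
  have "((\<lambda>j. ell2_unit i j *\<^sub>C f j) has_sum f i) I" if "i \<in> I" for i
  proof -
    have "((\<lambda>j. ell2_unit i j *\<^sub>C f j) has_sum f i) I \<longleftrightarrow> ((\<lambda>j. ell2_unit i j *\<^sub>C f j) has_sum f i) {i}"
      using that by (intro has_sum_cong_neutral) (auto simp: ell2_unit_def)
    thus ?thesis by (auto simp: ell2_unit_def intro!: has_sum_finiteI)
  qed
  thus "bounded_ell2_operator I ?T \<and> (\<forall>i\<in>I. ?T (ell2_unit i) = f i) \<and> (\<forall>c. c \<notin> ell2 I \<longrightarrow> ?T c = 0)"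
    using bessel_series_bounded_ell2_operator[OF assms] by (auto simp: ell2_unit_in infsumI)
next
  fix T
  assume T: "bounded_ell2_operator I T \<and> (\<forall>i\<in>I. T (ell2_unit i) = f i) \<and> (\<forall>c. c \<notin> ell2 I \<longrightarrow> T c = 0)"
  have "T c = ?T c" for c
  proof (cases "c \<in> ell2 I")
    case True
    thus ?thesis using T bounded_ell2_operator_has_sum[of I T f c] by (metis infsumI)
  qed (use T in simp)
  thus "T = ?T" by blast
qed

text \<open>The square root plays the role of the norm of the adjoint at \<open>x\<close>. The
  estimate is the limit of the finite Cauchy-Schwarz inequality, so the adjoint itself need not be
  constructed.\<close>

lemma cmod_hinner_synthesis_le:
  assumes "bessel_family I f" "c \<in> ell2 I"
  shows "cmod (hinner x (synthesis I f c))
    \<le> ell2_norm I c * sqrt (\<Sum>\<^sub>\<infinity>i\<in>I. (cmod (hinner x (f i)))\<^sup>2)"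
proof (rule tendsto_upperbound)
  have "((\<lambda>i. c i *\<^sub>C f i) has_sum synthesis I f c) I"
    using assms bessel_summable[OF assms] by (simp add: synthesis_eq)
  moreover have "isCont (hinner x) y" for y
    using continuous_on_ip_right[of UNIV x] by (simp add: continuous_on_eq_continuous_at)
  ultimately show "((\<lambda>F. cmod (hinner x (\<Sum>i\<in>F. c i *\<^sub>C f i)))
      \<longlongrightarrow> cmod (hinner x (synthesis I f c))) (finite_subsets_at_top I)"
    unfolding has_sum_def by (intro tendsto_norm isCont_tendsto_compose[of _ "hinner x"])
  have "cmod (hinner x (\<Sum>i\<in>F. c i *\<^sub>C f i))
      \<le> ell2_norm I c * sqrt (\<Sum>\<^sub>\<infinity>i\<in>I. (cmod (hinner x (f i)))\<^sup>2)" if F: "finite F" "F \<subseteq> I" for F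
    by (rule order_trans[OF cmod_ip_finite_sum_le mult_mono[OF
          L2_set_le_ell2_norm[OF assms(2) F] L2_set_hinner_le[OF assms(1) F]]])
      (simp_all add: ell2_norm_def infsum_nonneg)
  thus "\<forall>\<^sub>F F in finite_subsets_at_top I. cmod (hinner x (\<Sum>i\<in>F. c i *\<^sub>C f i))
      \<le> ell2_norm I c * sqrt (\<Sum>\<^sub>\<infinity>i\<in>I. (cmod (hinner x (f i)))\<^sup>2)"
    by (rule eventually_finite_subsets_at_top_weakI)
qed simp

section \<open>The lower frame bound\<close>

theorem j_frame_imp_hilbert_frame:
  assumes "j_frame I f"
  shows "hilbert_frame I f"
proof -
  have bessel: "bessel_family I f"
    and pos: "max_uniformly_pos (synthesis_pos I f ` ell2 I)"
    and neg: "max_uniformly_neg (synthesis_neg I f ` ell2 I)"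
    using assms by (auto simp: j_frame_def)
  obtain B where B: "B > 0" "\<And>x. (\<lambda>i. (cmod (hinner x (f i)))\<^sup>2) summable_on I"
    "\<And>x. (\<Sum>\<^sub>\<infinity>i\<in>I. (cmod (hinner x (f i)))\<^sup>2) \<le> B * (norm x)\<^sup>2"
    using bessel_bound[OF bessel] by metis
  define S where "S x = sqrt (\<Sum>\<^sub>\<infinity>i\<in>I. (cmod (hinner x (f i)))\<^sup>2)" for x
  have S_nonneg: "0 \<le> S x" for x by (simp add: S_def infsum_nonneg)
  have S_scale: "S (r *\<^sub>R x) = \<bar>r\<bar> * S x" for r x
    by (simp add: S_def ip_scale_left norm_mult power_mult_distrib infsum_cmult_right'
        real_sqrt_mult flip: of_real_scale)
  have "\<exists>C. \<forall>x\<in>{x. S x \<le> 1}. cmod (hinner x y) \<le> C" for y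
  proof -
    \<comment> \<open>Surjectivity enters here: \<open>y\<close> is a sum of two values of the same
      \<open>synthesis I f\<close> at the projected sequences \<open>c'\<close> and
      \<open>d'\<close>, whose norms bound the pairing wherever \<open>S x\<close> is at most
      1.\<close>
    obtain c d where cd: "c \<in> ell2 I" "d \<in> ell2 I" and y: "y = synthesis_pos I f c + synthesis_neg I f d"
      using max_uniform_sum[OF pos neg, of y] by blast
    define c' d' where "c' = ell2_proj (index_pos I f) c" and "d' = ell2_proj (index_neg I f) d"
    have cd': "c' \<in> ell2 I" "d' \<in> ell2 I"
      using cd by (auto simp: c'_def d'_def index_pos_def index_neg_def intro!: ell2_proj_in)
    have "cmod (hinner x y) \<le> ell2_norm I c' + ell2_norm I d'" if x: "S x \<le> 1" for x
    proof -
      have "hinner x y = hinner x (synthesis I f c') + hinner x (synthesis I f d')"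
        by (simp add: y ip_add_right c'_def d'_def synthesis_pos_def synthesis_neg_def)
      hence "cmod (hinner x y) \<le> ell2_norm I c' * S x + ell2_norm I d' * S x"
        unfolding S_def
        using norm_triangle_mono[OF cmod_hinner_synthesis_le[OF bessel cd'(1)]
            cmod_hinner_synthesis_le[OF bessel cd'(2)]] by simp
      also have "\<dots> \<le> ell2_norm I c' * 1 + ell2_norm I d' * 1"
        using x by (intro add_mono mult_left_mono) (auto simp: ell2_norm_def infsum_nonneg)
      finally show ?thesis by simp
    qed
    thus ?thesis by blast
  qed
  from uniform_boundedness[OF complete_UNIV_krein this]
  obtain M where M: "M > 0" "\<And>x. S x \<le> 1 \<Longrightarrow> norm x \<le> M"
    unfolding bounded_pos by blast
  have norm_le: "norm x \<le> M * S x" for x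
  proof (cases "S x = 0")
    case True
    \<comment> \<open>A nonzero \<open>x\<close> with \<open>S x = 0\<close>, rescaled to norm
      \<open>M + 1\<close>, would still lie in the set bounded by \<open>M\<close>.\<close>
    hence "norm (((M + 1) / norm x) *\<^sub>R x) \<le> M" by (intro M(2)) (simp add: S_scale)
    thus ?thesis using M(1) True by (cases "x = 0") auto
  next
    case False
    hence "S x > 0" using S_nonneg[of x] by simp
    moreover from this have "norm ((1 / S x) *\<^sub>R x) \<le> M" by (intro M(2)) (simp add: S_scale)
    ultimately show ?thesis by (simp add: field_simps)
  qed
  \<comment> \<open>The minimum with \<open>B\<close> secures \<open>A \<le> B\<close> also in the
    zero space, where the two frame inequalities do not imply it.\<close>
  define A where "A = min (inverse (M\<^sup>2)) B"
  have "A * (norm x)\<^sup>2 \<le> (\<Sum>\<^sub>\<infinity>i\<in>I. (cmod (hinner x (f i)))\<^sup>2)" for x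
  proof -
    have "A * (norm x)\<^sup>2 \<le> inverse (M\<^sup>2) * (M * S x)\<^sup>2"
      using norm_le[of x] by (intro mult_mono power_mono) (auto simp: A_def)
    also have "\<dots> = (S x)\<^sup>2" using M(1) by (simp add: power_mult_distrib)
    also have "\<dots> = (\<Sum>\<^sub>\<infinity>i\<in>I. (cmod (hinner x (f i)))\<^sup>2)"
      by (simp add: S_def infsum_nonneg)
    finally show ?thesis .
  qed
  moreover have "0 < A" "A \<le> B" using M(1) B(1) by (auto simp: A_def)
  ultimately show ?thesis
    unfolding hilbert_frame_def using B(2,3) by blast
qed

end

theorem mainTheorem2:
  fixes scale :: "complex \<Rightarrow> 'a::real_normed_vector \<Rightarrow> 'a"
    and form :: "'a \<Rightarrow> 'a \<Rightarrow> complex"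
    and Hp Hm :: "'a set"
    and I :: "'i set"
    and f :: "'i \<Rightarrow> 'a"
  assumes "krein_space scale form Hp Hm"
    and "krein_space.j_frame scale form Hp Hm I f"
  shows "krein_space.hilbert_frame form Hp Hm I f"
  using assms by (rule krein_space.j_frame_imp_hilbert_frame)

end
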